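(* For every integer $n\ge 1$, the matrix ring over dual numbers $M_n(\mathbb{D})$ is an $r$-clean ring.
   Context: $\mathbb{D}=\{a+b\epsilon \mid a,b\in\mathbb{R},\ \epsilon^2=0\}$ is the ring of dual numbers, and $M_n(\mathbb{D})$ is the ring of $n\times n$ matrices over $\mathbb{D}$. An element $r$ of a ring $R$ (associative with identity) is von Neumann regular if $r=rxr$ for some $x\in R$. An element $a\in R$ is $r$-clean if $a=r+e$ with $r\in R$ von Neumann regular and $e\in R$ idempotent. A ring is $r$-clean if every element of it is $r$-clean. *)

theory Defs
  imports "HOL-Algebra.Ring" "Jordan_Normal_Form.Matrix"
begin

text \<open>\<open>Dual a b\<close> stands for \<open>a + b\<epsilon>\<close> with \<open>\<epsilon>\<^sup>2 = 0\<close>; see \<open>dual_eps_squared\<close> and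
  \<open>Dual_eq\<close> below.\<close>

datatype dual_number = Dual (std_part: real) (eps_part: real)

lemma dual_number_eqI:
  "std_part x = std_part y \<Longrightarrow> eps_part x = eps_part y \<Longrightarrow> x = y"
  by (cases x; cases y) simp

instantiation dual_number :: "{comm_ring_1, real_algebra_1}"
begin

definition zero_dual_number :: dual_number where
  "0 = Dual 0 0"

definition one_dual_number :: dual_number where
  "1 = Dual 1 0"

definition plus_dual_number :: "dual_number \<Rightarrow> dual_number \<Rightarrow> dual_number" where
  "x + y = Dual (std_part x + std_part y) (eps_part x + eps_part y)"

definition uminus_dual_number :: "dual_number \<Rightarrow> dual_number" where
  "- x = Dual (- std_part x) (- eps_part x)"

definition minus_dual_number :: "dual_number \<Rightarrow> dual_number \<Rightarrow> dual_number" where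
  "x - y = Dual (std_part x - std_part y) (eps_part x - eps_part y)"

definition times_dual_number :: "dual_number \<Rightarrow> dual_number \<Rightarrow> dual_number" where
  "x * y = Dual (std_part x * std_part y)
                (std_part x * eps_part y + eps_part x * std_part y)"

definition scaleR_dual_number :: "real \<Rightarrow> dual_number \<Rightarrow> dual_number" where
  "scaleR c x = Dual (c * std_part x) (c * eps_part x)"

instance
  by standard
    (simp_all add: zero_dual_number_def one_dual_number_def plus_dual_number_def
      uminus_dual_number_def minus_dual_number_def times_dual_number_def
      scaleR_dual_number_def algebra_simps)

end

definition dual_eps :: dual_number where
  "dual_eps = Dual 0 1"

lemma dual_eps_squared: "dual_eps ^ 2 = 0"
  by (simp add: dual_eps_def power2_eq_square times_dual_number_def zero_dual_number_def)

lemma Dual_eq: "Dual a b = of_real a + of_real b * dual_eps"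
  by (simp add: of_real_def dual_eps_def scaleR_dual_number_def one_dual_number_def
      plus_dual_number_def times_dual_number_def)

definition von_neumann_regular :: "('a, 'm) ring_scheme \<Rightarrow> 'a \<Rightarrow> bool" where
  "von_neumann_regular R r \<longleftrightarrow>
     r \<in> carrier R \<and> (\<exists>x\<in>carrier R. r = r \<otimes>\<^bsub>R\<^esub> x \<otimes>\<^bsub>R\<^esub> r)"

definition idempotent_element :: "('a, 'm) ring_scheme \<Rightarrow> 'a \<Rightarrow> bool" where
  "idempotent_element R e \<longleftrightarrow> e \<in> carrier R \<and> e \<otimes>\<^bsub>R\<^esub> e = e"

definition r_clean_element :: "('a, 'm) ring_scheme \<Rightarrow> 'a \<Rightarrow> bool" where
  "r_clean_element R a \<longleftrightarrow>
     (\<exists>r e. von_neumann_regular R r \<and> idempotent_element R e \<and> a = r \<oplus>\<^bsub>R\<^esub> e)"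

definition r_clean_ring :: "('a, 'm) ring_scheme \<Rightarrow> bool" where
  "r_clean_ring R \<longleftrightarrow> ring R \<and> (\<forall>a\<in>carrier R. r_clean_element R a)"

end

theory Submission
  imports Defs "Jordan_Normal_Form.Determinant"
begin

text \<open>The determinant of \<open>A - diag(e\<^sub>1, \<dots>, e\<^sub>n)\<close> is affine in each \<open>e\<^sub>i\<close>, and the coefficient of
  \<open>e\<^sub>1 \<cdots> e\<^sub>n\<close> is \<open>\<plusminus>1\<close>; hence it is nonzero for some choice of
  \<open>e\<^sub>i \<in> {0, 1}\<close>. Applying this to the standard part of a dual number matrix, and using that a dual
  number with nonzero standard part is a unit, every matrix is the sum of a unit and a diagonal
  idempotent.\<close>

text \<open>The pattern \<open>d\<close> is a Boolean function, independent of the entry type, so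
  one \<open>d\<close> can serve over two different rings.\<close>

definition diag01_mat :: "nat \<Rightarrow> (nat \<Rightarrow> bool) \<Rightarrow> 'a :: {zero, one} mat" where
  "diag01_mat n d = mat n n (\<lambda>(i, j). if i = j \<and> d i then 1 else 0)"

lemma diag01_mat_carrier [simp]: "diag01_mat n d \<in> carrier_mat n n"
  by (simp add: diag01_mat_def)

lemma diag01_mat_dim [simp]:
  "dim_row (diag01_mat n d) = n" "dim_col (diag01_mat n d) = n"
  by (simp_all add: diag01_mat_def)

lemma diag01_mat_index [simp]:
  "i < n \<Longrightarrow> j < n \<Longrightarrow> diag01_mat n d $$ (i, j) = (if i = j \<and> d i then 1 else 0)"
  by (simp add: diag01_mat_def)

lemma diag01_mat_idem:
  "diag01_mat n d * diag01_mat n d = (diag01_mat n d :: 'a :: semiring_1 mat)"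
proof (rule eq_matI)
  fix i j
  assume "i < dim_row (diag01_mat n d :: 'a mat)" "j < dim_col (diag01_mat n d :: 'a mat)"
  then have ij: "i < n" "j < n" by simp_all
  have "(diag01_mat n d * diag01_mat n d :: 'a mat) $$ (i, j) =
      (\<Sum>k\<in>{0..<n}. (if i = k \<and> d i then 1 else 0) * (if k = j \<and> d k then 1 else 0))"
    using ij by (simp add: scalar_prod_def)
  also have "\<dots> = (\<Sum>k\<in>{0..<n}. if k = i then (if i = j \<and> d i then 1 else 0) else 0)"
    by (rule sum.cong) auto
  also have "\<dots> = (diag01_mat n d :: 'a mat) $$ (i, j)"
    using ij by (simp add: sum.delta)
  finally show "(diag01_mat n d * diag01_mat n d :: 'a mat) $$ (i, j) = diag01_mat n d $$ (i, j)" .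
qed simp_all

text \<open>The two matrices on the left differ only at \<open>(n, n)\<close>, by 1. Expanding along
  row \<open>n\<close>, whose cofactors do not see that row, leaves just the cofactor at
  \<open>(n, n)\<close>.\<close>

lemma det_minus_diag01_mat_Suc:
  fixes A :: "'a :: comm_ring_1 mat"
  assumes A: "A \<in> carrier_mat (Suc n) (Suc n)"
  shows "det (A - diag01_mat (Suc n) (d(n := False))) - det (A - diag01_mat (Suc n) (d(n := True)))
    = det (mat_delete A n n - diag01_mat n d)"
proof -
  define M where "M b = A - diag01_mat (Suc n) (d(n := b))" for b
  have carr: "M b \<in> carrier_mat (Suc n) (Suc n)" for b
    unfolding M_def by (rule minus_carrier_mat) simp
  have expand: "det (M b) = (\<Sum>j<Suc n. M b $$ (n, j) * cofactor (M b) n j)" for b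
    by (rule laplace_expansion_row[OF carr]) simp
  have "cofactor (M True) n j = cofactor (M False) n j" if "j < Suc n" for j
  proof -
    have "mat_delete (M True) n j = mat_delete (M False) n j"
      using A that by (intro eq_matI) (auto simp: mat_delete_def M_def)
    then show ?thesis by (simp add: cofactor_def)
  qed
  moreover have "M True $$ (n, j) = M False $$ (n, j)" if "j < n" for j
    using A that by (auto simp: M_def)
  ultimately have "det (M False) - det (M True)
      = (M False $$ (n, n) - M True $$ (n, n)) * cofactor (M False) n n"
    by (simp add: expand algebra_simps)
  also have "M False $$ (n, n) - M True $$ (n, n) = 1"
    using A by (simp add: M_def)
  also have "mat_delete (M False) n n = mat_delete A n n - diag01_mat n d"
    using A by (intro eq_matI) (auto simp: mat_delete_def M_def)
  then have "cofactor (M False) n n = det (mat_delete A n n - diag01_mat n d)"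
    \<comment> \<open>The cofactor sign has exponent \<open>n + n\<close>; written as
      \<open>2 * n\<close> it is visibly even.\<close>
    by (simp add: cofactor_def flip: mult_2)
  finally show ?thesis by (simp add: M_def)
qed

lemma ex_det_minus_diag01_mat_nonzero:
  fixes A :: "'a :: comm_ring_1 mat"
  assumes "A \<in> carrier_mat n n"
  shows "\<exists>d. det (A - diag01_mat n d) \<noteq> 0"
  using assms
proof (induction n arbitrary: A)
  case 0
  then have "A - diag01_mat 0 d \<in> carrier_mat 0 0" for d
    by (intro minus_carrier_mat) simp
  \<comment> \<open>The empty determinant is 1, which is nonzero in
    \<open>comm_ring_1\<close>.\<close>
  then show ?case by (simp add: det_dim_zero)
next
  case (Suc n)
  have "mat_delete A n n \<in> carrier_mat n n"
    using mat_delete_carrier[OF Suc.prems] by simp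
  from Suc.IH[OF this] obtain d where "det (mat_delete A n n - diag01_mat n d) \<noteq> 0" by blast
  then show ?case
    \<comment> \<open>If both choices of the last bit gave determinant 0, their difference would
      vanish too.\<close>
    using det_minus_diag01_mat_Suc[OF Suc.prems, of d] by (metis diff_self)
qed

text \<open>The adjugate divided by the determinant is a right inverse \<open>X\<close>, and
  \<open>A * X = 1\<close> already gives \<open>A * X * A = A\<close>.\<close>

lemma von_neumann_regular_mat_if_unit_det:
  fixes A :: "'a :: comm_ring_1 mat"
  assumes A: "A \<in> carrier_mat n n" and unit: "det A dvd 1"
  shows "von_neumann_regular (ring_mat TYPE('a) n b) A"
proof -
  from unit obtain c where c: "1 = det A * c" by (rule dvdE)
  define X where "X = c \<cdot>\<^sub>m adj_mat A"
  note adj = adj_mat[OF A]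
  have X: "X \<in> carrier_mat n n" using adj(1) by (simp add: X_def)
  have "A * X = c \<cdot>\<^sub>m (A * adj_mat A)"
    unfolding X_def by (rule mult_smult_distrib[OF A adj(1)])
  also have "\<dots> = (c * det A) \<cdot>\<^sub>m 1\<^sub>m n"
    unfolding adj(2) by (intro eq_matI) simp_all
  also have "\<dots> = 1\<^sub>m n"
    using c by (intro eq_matI) (simp_all add: mult.commute)
  finally have "A * X * A = A" using A by simp
  then show ?thesis
    using A X by (auto simp: von_neumann_regular_def ring_mat_def intro!: bexI[of _ X])
qed

text \<open>This isolates what is used about dual numbers: everything outside the kernel of
  \<open>h\<close> is a unit, so a determinant can be tested for invertibility after applying
  \<open>h\<close>.\<close>

theorem r_clean_ring_mat_if_units_reflected:
  fixes h :: "'a :: comm_ring_1 \<Rightarrow> 'b :: comm_ring_1"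
  assumes hom: "comm_ring_hom h" and unit: "\<And>x. h x \<noteq> 0 \<Longrightarrow> x dvd 1"
  shows "r_clean_ring (ring_mat TYPE('a) n b)"
proof -
  interpret comm_ring_hom h by (rule hom)
  have "r_clean_element (ring_mat TYPE('a) n b) A" if A: "A \<in> carrier_mat n n" for A :: "'a mat"
  proof -
    have "map_mat h A \<in> carrier_mat n n" using A by simp
    then obtain d where d: "det (map_mat h A - diag01_mat n d) \<noteq> 0"
      using ex_det_minus_diag01_mat_nonzero by blast
    \<comment> \<open>The pattern found over \<open>'b\<close> is reused over \<open>'a\<close>;
      \<open>h\<close> preserves 0 and 1, so it maps \<open>E\<close> to the matrix subtracted
      above.\<close>
    define E :: "'a mat" where "E = diag01_mat n d"
    have E: "E \<in> carrier_mat n n" by (simp add: E_def)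
    have "map_mat h (A - E) = map_mat h A - diag01_mat n d"
      using A by (intro eq_matI) (auto simp: E_def hom_minus)
    then have "h (det (A - E)) \<noteq> 0" using d by (simp flip: hom_det)
    then have "von_neumann_regular (ring_mat TYPE('a) n b) (A - E)"
      using E by (intro von_neumann_regular_mat_if_unit_det unit minus_carrier_mat)
    moreover have "idempotent_element (ring_mat TYPE('a) n b) E"
      by (simp add: idempotent_element_def ring_mat_def E_def diag01_mat_idem)
    moreover have "A = A - E + E" using A E by (intro eq_matI) auto
    ultimately show ?thesis unfolding r_clean_element_def by (auto simp: ring_mat_def)
  qed
  then show ?thesis
    by (simp add: r_clean_ring_def ring_mat) (simp add: ring_mat_def)
qed

lemma comm_ring_hom_std_part: "comm_ring_hom std_part"
  by unfold_locales (simp_all add: zero_dual_number_def one_dual_number_def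
      plus_dual_number_def times_dual_number_def)

lemma dual_number_unit:
  assumes "std_part x \<noteq> 0"
  shows "x dvd 1"
proof
  \<comment> \<open>The witness comes from (a + b\<epsilon>)(a - b\<epsilon>) = a^2.\<close>
  show "1 = x * Dual (1 / std_part x) (- eps_part x / (std_part x)\<^sup>2)"
    using assms
    by (simp add: one_dual_number_def times_dual_number_def field_simps power2_eq_square)
qed

theorem corollary4p8:
  fixes n :: nat
  assumes "n \<ge> 1"
  shows "r_clean_ring (ring_mat TYPE(dual_number) n ())"
  by (rule r_clean_ring_mat_if_units_reflected[OF comm_ring_hom_std_part dual_number_unit])

end
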